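(* Consider a min-plus linear system with random service process $S_\omega(\tau,t)$, $\omega\in\Omega$. Fix $t>0$ and $\varepsilon\in(0,1]$, and let $\Psi_t\subseteq\Omega$ be a (non-empty) set of sample paths with $\mathsf{P}[\Psi_t]\ge1-\varepsilon$. Define, for $\tau\in[0,t]$, $$\mathcal{S}_{br}^{\varepsilon}(\tau,t)=\inf_{\psi\in\Psi_t}\{S_\psi(0,t)-S_\psi(0,\tau)\},\qquad \widetilde{A}_{mp}(\tau)=\mathcal{S}_{br}^{\varepsilon}(0,t)-\mathcal{S}_{br}^{\varepsilon}(\tau,t).$$ Let $B(t)=\widetilde{A}_{mp}(t)-D(t)$ be the backlog at time $t$ caused by the probe $\widetilde{A}_{mp}$, where $D(t)=\inf_{\tau\in[0,t]}\{\widetilde{A}_{mp}(\tau)+S(\tau,t)\}$, let $B^{\varepsilon}(t)$ be its $(1-\varepsilon)$-quantile, and let $\mathcal{S}_{mp}^{\varepsilon}(\tau,t)=\widetilde{A}_{mp}(t)-\widetilde{A}_{mp}(\tau)-B^{\varepsilon}(t)$. Then: (a) $\mathcal{S}_{mp}^{\varepsilon}(\tau,t)=\mathcal{S}_{br}^{\varepsilon}(\tau,t)-B^{\varepsilon}(t)$ for all $\tau\in[0,t]$; (b) for every sample path $\varphi\in\Psi_t$, $B_\varphi(t)\le\Delta_\varphi(0,t):=S_\varphi(0,t)-\inf_{\tau\in[0,t]}\{S_\varphi(0,\tau)+S_\varphi(\tau,t)\}$; (c) if $S$ is additive (for every sample path), then $B_\varphi(t)=0$ for all $\varphi\in\Psi_t$,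 $B^{\varepsilon}(t)=0$, and $\mathcal{S}_{mp}^{\varepsilon}(\tau,t)=\mathcal{S}_{br}^{\varepsilon}(\tau,t)$ for all $\tau\in[0,t]$; the same holds if $S$ is sub-additive.
   Context: A random service process $S(\tau,t)$, $t\ge\tau\ge0$, is a family of non-negative real random variables on a probability space $\Omega$ with $S(t,t)=0$ for all $t\ge0$; $S_\omega$ is its sample path for $\omega\in\Omega$, and $B_\omega(t)$ the corresponding value of the backlog. The system is min-plus linear: cumulative arrivals $A$ produce the cumulative departures $D(t)=\inf_{\tau\in[0,t]}\{A(\tau)+S(\tau,t)\}$. The burst response $S_\omega(0,\tau)$ (the cumulative departures when an infinite burst is sent at time $0$) is non-decreasing in $\tau$. $S$ is additive if $S(s,u)=S(s,t)+S(t,u)$, and sub-additive if $S(s,u)\le S(s,t)+S(t,u)$, for all $u\ge t\ge s\ge0$. The $(1-\varepsilon)$-quantile of a random variable $X\ge 0$ is $X^{\varepsilon}=\inf\{x\ge0:\mathsf{P}[X\le x]\ge1-\varepsilon\}$. *)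

theory Defs
  imports "HOL-Probability.Probability"
begin

text \<open>A sample path of a service process is a function of type
  \<^typ>\<open>real \<Rightarrow> real \<Rightarrow> real\<close>, taking the two times \<open>\<tau>\<close> and \<open>t\<close>. Only its
  values for \<open>0 \<le> \<tau> \<le> t\<close> are meaningful.\<close>

locale service_process = prob_space M
  for M :: "'a measure" +
  fixes S :: "'a \<Rightarrow> real \<Rightarrow> real \<Rightarrow> real"
  assumes random_variable_S:
      "\<And>\<tau> t. 0 \<le> \<tau> \<Longrightarrow> \<tau> \<le> t \<Longrightarrow> random_variable borel (\<lambda>\<omega>. S \<omega> \<tau> t)"
    and nonneg_S:
      "\<And>\<omega> \<tau> t. \<omega> \<in> space M \<Longrightarrow> 0 \<le> \<tau> \<Longrightarrow> \<tau> \<le> t \<Longrightarrow> 0 \<le> S \<omega> \<tau> t"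
    and diag_S: "\<And>\<omega> t. \<omega> \<in> space M \<Longrightarrow> 0 \<le> t \<Longrightarrow> S \<omega> t t = 0"
    and burst_response_mono: "\<And>\<omega>. \<omega> \<in> space M \<Longrightarrow> mono_on {0..} (S \<omega> 0)"

definition additive_path :: "(real \<Rightarrow> real \<Rightarrow> real) \<Rightarrow> bool" where
  "additive_path s \<longleftrightarrow>
     (\<forall>r t u. 0 \<le> r \<longrightarrow> r \<le> t \<longrightarrow> t \<le> u \<longrightarrow> s r u = s r t + s t u)"

definition subadditive_path :: "(real \<Rightarrow> real \<Rightarrow> real) \<Rightarrow> bool" where
  "subadditive_path s \<longleftrightarrow>
     (\<forall>r t u. 0 \<le> r \<longrightarrow> r \<le> t \<longrightarrow> t \<le> u \<longrightarrow> s r u \<le> s r t + s t u)"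

definition departures :: "(real \<Rightarrow> real) \<Rightarrow> (real \<Rightarrow> real \<Rightarrow> real) \<Rightarrow> real \<Rightarrow> real" where
  "departures A s t = (INF \<tau>\<in>{0..t}. A \<tau> + s \<tau> t)"

definition backlog :: "(real \<Rightarrow> real) \<Rightarrow> (real \<Rightarrow> real \<Rightarrow> real) \<Rightarrow> real \<Rightarrow> real" where
  "backlog A s t = A t - departures A s t"

text \<open>The \<open>(1 - \<epsilon>)\<close>-quantile of a non-negative random variable. It is meaningful
  only for measurable \<open>X\<close>, as \<^const>\<open>measure\<close> is \<open>0\<close> on non-measurable sets.\<close>

definition quantile :: "'a measure \<Rightarrow> ('a \<Rightarrow> real) \<Rightarrow> real \<Rightarrow> real" where
  "quantile M X \<epsilon> = Inf {x. 0 \<le> x \<and> measure M {\<omega> \<in> space M. X \<omega> \<le> x} \<ge> 1 - \<epsilon>}"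

definition S_br :: "('a \<Rightarrow> real \<Rightarrow> real \<Rightarrow> real) \<Rightarrow> 'a set \<Rightarrow> real \<Rightarrow> real \<Rightarrow> real" where
  "S_br S \<Psi> \<tau> t = (INF \<psi>\<in>\<Psi>. S \<psi> 0 t - S \<psi> 0 \<tau>)"

text \<open>The probe depends on the time \<open>t\<close> at which its backlog is observed.\<close>

definition A_mp :: "('a \<Rightarrow> real \<Rightarrow> real \<Rightarrow> real) \<Rightarrow> 'a set \<Rightarrow> real \<Rightarrow> real \<Rightarrow> real" where
  "A_mp S \<Psi> t \<tau> = S_br S \<Psi> 0 t - S_br S \<Psi> \<tau> t"

definition B_mp :: "('a \<Rightarrow> real \<Rightarrow> real \<Rightarrow> real) \<Rightarrow> 'a set \<Rightarrow> real \<Rightarrow> 'a \<Rightarrow> real" where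
  "B_mp S \<Psi> t \<omega> = backlog (A_mp S \<Psi> t) (S \<omega>) t"

definition S_mp ::
  "'a measure \<Rightarrow> ('a \<Rightarrow> real \<Rightarrow> real \<Rightarrow> real) \<Rightarrow> 'a set \<Rightarrow> real \<Rightarrow> real \<Rightarrow> real \<Rightarrow> real" where
  "S_mp M S \<Psi> \<epsilon> \<tau> t =
     A_mp S \<Psi> t t - A_mp S \<Psi> t \<tau> - quantile M (B_mp S \<Psi> t) \<epsilon>"

text \<open>The deviation \<open>\<Delta>(0, t)\<close> of a sample path from sub-additivity.\<close>

definition \<Delta> :: "(real \<Rightarrow> real \<Rightarrow> real) \<Rightarrow> real \<Rightarrow> real" where
  "\<Delta> s t = s 0 t - (INF \<tau>\<in>{0..t}. s 0 \<tau> + s \<tau> t)"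

end

theory Submission
  imports Defs
begin

text \<open>The infimum defining \<open>S_br\<close> bounds the increment of the probe over \<open>[\<tau>, t]\<close> by the increment
  of the burst response of each path in \<open>\<Psi>\<close>. This gives the bound by \<open>\<Delta>\<close>, which is at most \<open>0\<close> for a
  sub-additive path, while choosing \<open>\<tau> = t\<close> in the departures shows that the backlog is
  non-negative.\<close>

context service_process
begin

text \<open>Monotonicity of the burst response makes every increment non-negative, so 0 bounds the
  family below and the real-valued infimum really is a lower bound.\<close>

lemma S_br_le:
  assumes "\<Psi> \<subseteq> space M" and "\<psi> \<in> \<Psi>" and "0 \<le> \<tau>" and "\<tau> \<le> t"
  shows "S_br S \<Psi> \<tau> t \<le> S \<psi> 0 t - S \<psi> 0 \<tau>"
  unfolding S_br_def
proof (rule cINF_lower[OF _ assms(2)])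
  have "0 \<le> S \<omega> 0 t - S \<omega> 0 \<tau>" if "\<omega> \<in> \<Psi>" for \<omega>
    using mono_onD[OF burst_response_mono, of \<omega> \<tau> t] that assms by auto
  then show "bdd_below ((\<lambda>\<omega>. S \<omega> 0 t - S \<omega> 0 \<tau>) ` \<Psi>)"
    by (intro bdd_belowI2[where m = 0])
qed

text \<open>The two copies of \<open>S_br S \<Psi> 0 t\<close> cancel, and
  \<open>S_br S \<Psi> t t\<close> is the infimum of the constant 0, which equals 0 because
  \<open>\<Psi>\<close> is non-empty.\<close>

lemma A_mp_increment:
  assumes "\<Psi> \<noteq> {}"
  shows "A_mp S \<Psi> t t - A_mp S \<Psi> t \<tau> = S_br S \<Psi> \<tau> t"
  using assms by (simp add: A_mp_def S_br_def)

lemma A_mp_lower: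
  assumes "\<Psi> \<subseteq> space M" and "\<psi> \<in> \<Psi>" and "0 \<le> \<tau>" and "\<tau> \<le> t"
  shows "A_mp S \<Psi> t t - S \<psi> 0 t + S \<psi> 0 \<tau> \<le> A_mp S \<Psi> t \<tau>"
  using S_br_le[OF assms] A_mp_increment[of \<Psi> t \<tau>] assms(2) by force

lemma B_mp_le_\<Delta>:
  assumes "\<Psi> \<subseteq> space M" and "\<phi> \<in> \<Psi>" and "0 \<le> t"
  shows "B_mp S \<Psi> t \<phi> \<le> \<Delta> (S \<phi>) t"
proof -
  let ?I = "INF \<tau>\<in>{0..t}. S \<phi> 0 \<tau> + S \<phi> \<tau> t"
  have "\<phi> \<in> space M"
    using assms by auto
  then have bdd: "bdd_below ((\<lambda>\<tau>. S \<phi> 0 \<tau> + S \<phi> \<tau> t) ` {0..t})"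
    by (intro bdd_belowI2[where m = 0]) (simp add: nonneg_S)
  \<comment> \<open>By \<open>A_mp_lower\<close>, each term of the infimum is at least
    \<open>A_mp S \<Psi> t t - S \<phi> 0 t\<close> plus
    \<open>S \<phi> 0 \<tau> + S \<phi> \<tau> t\<close>. Only the second part varies with
    \<open>\<tau>\<close>, and \<open>?I\<close> is its infimum.\<close>
  have "A_mp S \<Psi> t t - S \<phi> 0 t + ?I \<le> departures (A_mp S \<Psi> t) (S \<phi>) t"
    unfolding departures_def
  proof (rule cINF_greatest)
    show "A_mp S \<Psi> t t - S \<phi> 0 t + ?I \<le> A_mp S \<Psi> t \<tau> + S \<phi> \<tau> t" if "\<tau> \<in> {0..t}" for \<tau>
      using cINF_lower[OF bdd that] A_mp_lower[of \<Psi> \<phi> \<tau> t] assms that by auto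
  qed (use assms in simp)
  then show ?thesis
    by (simp add: B_mp_def backlog_def \<Delta>_def)
qed

lemma B_mp_nonneg:
  assumes "\<Psi> \<subseteq> space M" and "\<Psi> \<noteq> {}" and "\<omega> \<in> space M" and "0 \<le> t"
  shows "0 \<le> B_mp S \<Psi> t \<omega>"
proof -
  obtain \<psi> where \<psi>: "\<psi> \<in> \<Psi>"
    using assms by auto
  \<comment> \<open>A bound uniform in \<open>\<tau>\<close> is required, since the infimum of a set
    unbounded below has no useful value. Any path \<open>\<psi>\<close> of \<open>\<Psi>\<close>
    supplies one, even when \<open>\<omega>\<close> lies outside \<open>\<Psi>\<close>.\<close>
  have "A_mp S \<Psi> t t - S \<psi> 0 t \<le> A_mp S \<Psi> t \<tau> + S \<omega> \<tau> t" if "\<tau> \<in> {0..t}" for \<tau>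
  proof -
    have "0 \<le> S \<psi> 0 \<tau>" and "0 \<le> S \<omega> \<tau> t"
      using that assms \<psi> by (auto intro: nonneg_S)
    then show ?thesis
      using A_mp_lower[OF assms(1) \<psi>, of \<tau> t] that by simp
  qed
  then have "bdd_below ((\<lambda>\<tau>. A_mp S \<Psi> t \<tau> + S \<omega> \<tau> t) ` {0..t})"
    by (rule bdd_belowI2)
  then have "departures (A_mp S \<Psi> t) (S \<omega>) t \<le> A_mp S \<Psi> t t + S \<omega> t t"
    unfolding departures_def using assms(4) by (intro cINF_lower) auto
  then show ?thesis
    using assms by (simp add: B_mp_def backlog_def diag_S)
qed

end

text \<open>Splitting \<open>[0, t]\<close> at any \<open>\<tau>\<close> shows that
  \<open>s 0 t\<close> is a lower bound of the sums whose infimum is subtracted in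
  \<open>\<Delta>\<close>.\<close>

lemma \<Delta>_nonpos_if_subadditive:
  assumes "subadditive_path s" and "0 \<le> t"
  shows "\<Delta> s t \<le> 0"
proof -
  have "s 0 t \<le> (INF \<tau>\<in>{0..t}. s 0 \<tau> + s \<tau> t)"
    using assms by (intro cINF_greatest) (auto simp: subadditive_path_def)
  then show ?thesis
    by (simp add: \<Delta>_def)
qed

lemma additive_imp_subadditive_path: "additive_path s \<Longrightarrow> subadditive_path s"
  unfolding additive_path_def subadditive_path_def by (blast intro: eq_refl)

text \<open>The event \<open>X \<le> 0\<close> contains \<open>\<Psi>\<close>, so the level 0
  already has enough probability. Admissible levels are non-negative, hence 0 is their minimum.
  Measurability of \<open>X\<close> lets the measures be compared.\<close>

lemma (in finite_measure) quantile_eq_0: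
  assumes "X \<in> borel_measurable M" and "\<Psi> \<in> sets M" and "1 - \<epsilon> \<le> measure M \<Psi>"
    and "\<And>\<omega>. \<omega> \<in> \<Psi> \<Longrightarrow> X \<omega> \<le> 0"
  shows "quantile M X \<epsilon> = 0"
  unfolding quantile_def
proof (rule cInf_eq_minimum)
  have "measure M \<Psi> \<le> measure M {\<omega> \<in> space M. X \<omega> \<le> 0}"
    using assms sets.sets_into_space by (intro finite_measure_mono) auto
  then show "0 \<in> {x. 0 \<le> x \<and> 1 - \<epsilon> \<le> measure M {\<omega> \<in> space M. X \<omega> \<le> x}}"
    using assms(3) by simp
qed simp

theorem mainTheorem11:
  fixes M :: "'a measure"
    and S :: "'a \<Rightarrow> real \<Rightarrow> real \<Rightarrow> real"
    and \<Psi> :: "'a set"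
    and t \<epsilon> :: real
  assumes "service_process M S"
    and "0 < t"
    and "0 < \<epsilon>" and "\<epsilon> \<le> 1"
    and "\<Psi> \<in> sets M" and "\<Psi> \<noteq> {}"
    and "measure M \<Psi> \<ge> 1 - \<epsilon>"
    and "B_mp S \<Psi> t \<in> borel_measurable M"
  shows "(\<forall>\<tau>\<in>{0..t}. S_mp M S \<Psi> \<epsilon> \<tau> t = S_br S \<Psi> \<tau> t - quantile M (B_mp S \<Psi> t) \<epsilon>)
    \<and> (\<forall>\<phi>\<in>\<Psi>. B_mp S \<Psi> t \<phi> \<le> \<Delta> (S \<phi>) t)
    \<and> ((\<forall>\<omega>\<in>space M. additive_path (S \<omega>)) \<longrightarrow>
         (\<forall>\<phi>\<in>\<Psi>. B_mp S \<Psi> t \<phi> = 0)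
         \<and> quantile M (B_mp S \<Psi> t) \<epsilon> = 0
         \<and> (\<forall>\<tau>\<in>{0..t}. S_mp M S \<Psi> \<epsilon> \<tau> t = S_br S \<Psi> \<tau> t))
    \<and> ((\<forall>\<omega>\<in>space M. subadditive_path (S \<omega>)) \<longrightarrow>
         (\<forall>\<phi>\<in>\<Psi>. B_mp S \<Psi> t \<phi> = 0)
         \<and> quantile M (B_mp S \<Psi> t) \<epsilon> = 0
         \<and> (\<forall>\<tau>\<in>{0..t}. S_mp M S \<Psi> \<epsilon> \<tau> t = S_br S \<Psi> \<tau> t))"
proof -
  interpret service_process M S
    by fact
  have \<Psi>: "\<Psi> \<subseteq> space M"
    using assms(5) by (rule sets.sets_into_space)
  have a: "S_mp M S \<Psi> \<epsilon> \<tau> t = S_br S \<Psi> \<tau> t - quantile M (B_mp S \<Psi> t) \<epsilon>" for \<tau>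
    using A_mp_increment[OF assms(6)] by (simp add: S_mp_def)
  have b: "B_mp S \<Psi> t \<phi> \<le> \<Delta> (S \<phi>) t" if "\<phi> \<in> \<Psi>" for \<phi>
    using B_mp_le_\<Delta>[OF \<Psi> that] assms(2) by simp
  \<comment> \<open>Only the sub-additive case is argued; the additive one reduces to it through
    \<open>additive_imp_subadditive_path\<close>.\<close>
  have c: "(\<forall>\<phi>\<in>\<Psi>. B_mp S \<Psi> t \<phi> = 0) \<and> quantile M (B_mp S \<Psi> t) \<epsilon> = 0
      \<and> (\<forall>\<tau>\<in>{0..t}. S_mp M S \<Psi> \<epsilon> \<tau> t = S_br S \<Psi> \<tau> t)"
    if sub: "\<forall>\<omega>\<in>space M. subadditive_path (S \<omega>)"
  proof -
    have B0: "B_mp S \<Psi> t \<phi> = 0" if "\<phi> \<in> \<Psi>" for \<phi>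
    proof (rule antisym)
      show "B_mp S \<Psi> t \<phi> \<le> 0"
      proof (rule order_trans[OF b[OF that]])
        show "\<Delta> (S \<phi>) t \<le> 0"
          using sub \<Psi> that assms(2) by (intro \<Delta>_nonpos_if_subadditive) auto
      qed
      show "0 \<le> B_mp S \<Psi> t \<phi>"
        using B_mp_nonneg[OF \<Psi> assms(6), of \<phi> t] \<Psi> that assms(2) by auto
    qed
    then have "quantile M (B_mp S \<Psi> t) \<epsilon> = 0"
      using quantile_eq_0[OF assms(8,5,7)] by simp
    then show ?thesis
      using B0 a by simp
  qed
  show ?thesis
    using a b c additive_imp_subadditive_path by blast
qed

end
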